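(* Suppose the monitoring sets are pairwise disjoint, i.e. $U_x\cap U_{x'}=\emptyset$ for all $x\ne x'$ in $\mathcal{X}$. Then $z^*_{(\overline{\mathcal{M}})}=z^*_{(\mathcal{M})}$. Furthermore, writing $\mathcal{X}=\{x_1,\dots,x_n\}$ with $n=|\mathcal{X}|$ and $\overline{\varphi}_{x_1}\le\cdots\le\overline{\varphi}_{x_n}$, any monitoring strategy $\sigma^1\in\Delta^1$ satisfying $$\mathbb{P}_{X\sim\sigma^1}(x\in X)=\begin{cases}1-\dfrac{k^*_{\mathcal{X}}-r}{(1-\overline{\varphi}_x)S^{k^*}_{\mathcal{X}}}, & \text{if } x\in\{x_1,\dots,x_{k^*_{\mathcal{X}}}\},\\ 0,&\text{otherwise,}\end{cases}\qquad\text{for all }x\in\mathcal{X},$$ is an optimal solution of the network monitoring problem $(\mathcal{M})$.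
   Context: Setting: $\mathcal{U}$ is a finite set of components and $\mathcal{X}$ a finite set of sensor locations. Each $u\in\mathcal{U}$ has a security level $\varphi_u\in[0,1)$. Each $x\in\mathcal{X}$ has a nonempty monitoring set $U_x\subseteq\mathcal{U}$; for $C\subseteq\mathcal{X}$, $U_C=\bigcup_{x\in C}U_x$; every component belongs to at least one monitoring set, i.e. $U_{\mathcal{X}}=\mathcal{U}$. A set cover is a $C\subseteq\mathcal{X}$ with $U_C=\mathcal{U}$, and $n^*$ is the minimum size of a set cover. The number of sensors is a positive integer $r$ with $r<n^*$. $\mathcal{A}=\{X\subseteq\mathcal{X} : |X|\le r\}$, and $\Delta^1$ is the set of probability distributions $\sigma^1$ on $\mathcal{A}$ (monitoring strategies), $\sigma^1_X$ being the probability of $X$. The node basis of $\sigma^1$ is $\mathcal{X}(\sigma^1)=\bigcup_{X:\sigma^1_X>0}X$. For $X\in\mathcal{A}$, $u\in\mathcal{U}$: $f(X,u)=1$ if $u\in U_X$ and $f(X,u)=\varphi_u$ otherwise. For $x\in\mathcal{X}$: $\overline{\varphi}_x=\min_{u\in U_x}\varphi_u$, and $\bar f(X,x)=1$ if $x\in X$, $\bar f(X,x)=\overline{\varphi}_x$ otherwise. Problem $(\mathcal{M})$ is $\max_{\sigma^1\in\Delta^1}\min_{u\in\mathcal{U}}\mathbb{E}_{X\sim\sigma^1}[f(X,u)]$, with optimal value $z^*_{(\mathcal{M})}$. Also $$z^*_{(\overline{\mathcal{M}})}=\max_{\sigma^1\in\Delta^1}\min\Big\{\min_{x\in\mathcal{X}(\sigma^1)}\mathbb{E}_{X\sim\sigma^1}[\bar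 f(X,x)],\ \min_{u\notin U_{\mathcal{X}(\sigma^1)}}\varphi_u\Big\},$$ where a minimum over an empty set is $+\infty$. With the locations indexed so that $\overline{\varphi}_{x_1}\le\cdots\le\overline{\varphi}_{x_n}$, $$k^*_{\mathcal{X}}=\max\Big\{k\in\{1,\dots,n\} : \overline{\varphi}_{x_k}\le 1-\frac{k-r}{\sum_{l=1}^k(1-\overline{\varphi}_{x_l})^{-1}}\Big\},\qquad S^{k^*}_{\mathcal{X}}=\sum_{l=1}^{k^*_{\mathcal{X}}}(1-\overline{\varphi}_{x_l})^{-1}.$$ *)

theory Defs
  imports "HOL-Probability.Probability"
begin

text \<open>
  Components have type \<open>'c\<close>, sensor locations type \<open>'l\<close>. Throughout, \<open>\<U>\<close> is the set of
  components, \<open>\<X>\<close> the set of locations, \<open>U x\<close> the monitoring set of location \<open>x\<close>,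
  \<open>\<phi> u\<close> the security level of component \<open>u\<close>, and \<open>r\<close> the number of sensors.
\<close>

definition monitored :: "('l \<Rightarrow> 'c set) \<Rightarrow> 'l set \<Rightarrow> 'c set" where
  "monitored U C = (\<Union>x\<in>C. U x)"

definition set_cover :: "'c set \<Rightarrow> 'l set \<Rightarrow> ('l \<Rightarrow> 'c set) \<Rightarrow> 'l set \<Rightarrow> bool" where
  "set_cover \<U> \<X> U C \<longleftrightarrow> C \<subseteq> \<X> \<and> monitored U C = \<U>"

definition min_cover_size :: "'c set \<Rightarrow> 'l set \<Rightarrow> ('l \<Rightarrow> 'c set) \<Rightarrow> nat" where
  "min_cover_size \<U> \<X> U = Min (card ` {C. set_cover \<U> \<X> U C})"

definition sensor_placements :: "'l set \<Rightarrow> nat \<Rightarrow> 'l set set" where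
  "sensor_placements \<X> r = {X. X \<subseteq> \<X> \<and> card X \<le> r}"

definition strategies :: "'l set \<Rightarrow> nat \<Rightarrow> 'l set pmf set" where
  "strategies \<X> r = {\<sigma>. set_pmf \<sigma> \<subseteq> sensor_placements \<X> r}"

definition node_basis :: "'l set pmf \<Rightarrow> 'l set" where
  "node_basis \<sigma> = \<Union> (set_pmf \<sigma>)"

definition detect :: "('l \<Rightarrow> 'c set) \<Rightarrow> ('c \<Rightarrow> real) \<Rightarrow> 'l set \<Rightarrow> 'c \<Rightarrow> real" where
  "detect U \<phi> X u = (if u \<in> monitored U X then 1 else \<phi> u)"

definition phi_bar :: "('l \<Rightarrow> 'c set) \<Rightarrow> ('c \<Rightarrow> real) \<Rightarrow> 'l \<Rightarrow> real" where
  "phi_bar U \<phi> x = Min (\<phi> ` U x)"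

definition detect_bar :: "('l \<Rightarrow> 'c set) \<Rightarrow> ('c \<Rightarrow> real) \<Rightarrow> 'l set \<Rightarrow> 'l \<Rightarrow> real" where
  "detect_bar U \<phi> X x = (if x \<in> X then 1 else phi_bar U \<phi> x)"

text \<open>
  Objective values are extended reals, so that an infimum over the empty set is \<open>\<infinity>\<close>;
  over a finite nonempty set the infimum is the minimum.
\<close>

definition obj_M :: "'c set \<Rightarrow> ('l \<Rightarrow> 'c set) \<Rightarrow> ('c \<Rightarrow> real) \<Rightarrow> 'l set pmf \<Rightarrow> ereal" where
  "obj_M \<U> U \<phi> \<sigma> =
     (INF u\<in>\<U>. ereal (measure_pmf.expectation \<sigma> (\<lambda>X. detect U \<phi> X u)))"

definition obj_M_bar :: "'c set \<Rightarrow> ('l \<Rightarrow> 'c set) \<Rightarrow> ('c \<Rightarrow> real) \<Rightarrow> 'l set pmf \<Rightarrow> ereal" where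
  "obj_M_bar \<U> U \<phi> \<sigma> =
     min (INF x\<in>node_basis \<sigma>.
            ereal (measure_pmf.expectation \<sigma> (\<lambda>X. detect_bar U \<phi> X x)))
         (INF u\<in>\<U> - monitored U (node_basis \<sigma>). ereal (\<phi> u))"

definition z_M :: "'c set \<Rightarrow> 'l set \<Rightarrow> ('l \<Rightarrow> 'c set) \<Rightarrow> ('c \<Rightarrow> real) \<Rightarrow> nat \<Rightarrow> ereal" where
  "z_M \<U> \<X> U \<phi> r = (SUP \<sigma>\<in>strategies \<X> r. obj_M \<U> U \<phi> \<sigma>)"

definition z_M_bar :: "'c set \<Rightarrow> 'l set \<Rightarrow> ('l \<Rightarrow> 'c set) \<Rightarrow> ('c \<Rightarrow> real) \<Rightarrow> nat \<Rightarrow> ereal" where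
  "z_M_bar \<U> \<X> U \<phi> r = (SUP \<sigma>\<in>strategies \<X> r. obj_M_bar \<U> U \<phi> \<sigma>)"

definition optimal_M ::
  "'c set \<Rightarrow> 'l set \<Rightarrow> ('l \<Rightarrow> 'c set) \<Rightarrow> ('c \<Rightarrow> real) \<Rightarrow> nat \<Rightarrow> 'l set pmf \<Rightarrow> bool" where
  "optimal_M \<U> \<X> U \<phi> r \<sigma> \<longleftrightarrow>
     is_arg_max (obj_M \<U> U \<phi>) (\<lambda>\<tau>. \<tau> \<in> strategies \<X> r) \<sigma>"

definition optimal_M_bar ::
  "'c set \<Rightarrow> 'l set \<Rightarrow> ('l \<Rightarrow> 'c set) \<Rightarrow> ('c \<Rightarrow> real) \<Rightarrow> nat \<Rightarrow> 'l set pmf \<Rightarrow> bool" where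
  "optimal_M_bar \<U> \<X> U \<phi> r \<sigma> \<longleftrightarrow>
     is_arg_max (obj_M_bar \<U> U \<phi>) (\<lambda>\<tau>. \<tau> \<in> strategies \<X> r) \<sigma>"

definition sorted_enumeration ::
  "'l set \<Rightarrow> ('l \<Rightarrow> 'c set) \<Rightarrow> ('c \<Rightarrow> real) \<Rightarrow> (nat \<Rightarrow> 'l) \<Rightarrow> bool" where
  "sorted_enumeration \<X> U \<phi> x \<longleftrightarrow>
     bij_betw x {1..card \<X>} \<X> \<and> mono_on {1..card \<X>} (\<lambda>i. phi_bar U \<phi> (x i))"

definition inv_sum :: "('l \<Rightarrow> 'c set) \<Rightarrow> ('c \<Rightarrow> real) \<Rightarrow> (nat \<Rightarrow> 'l) \<Rightarrow> nat \<Rightarrow> real" where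
  "inv_sum U \<phi> x k = (\<Sum>l=1..k. inverse (1 - phi_bar U \<phi> (x l)))"

definition k_star ::
  "'l set \<Rightarrow> ('l \<Rightarrow> 'c set) \<Rightarrow> ('c \<Rightarrow> real) \<Rightarrow> nat \<Rightarrow> (nat \<Rightarrow> 'l) \<Rightarrow> nat" where
  "k_star \<X> U \<phi> r x =
     Max {k \<in> {1..card \<X>}.
            phi_bar U \<phi> (x k) \<le> 1 - (real k - real r) / inv_sum U \<phi> x k}"

definition S_star ::
  "'l set \<Rightarrow> ('l \<Rightarrow> 'c set) \<Rightarrow> ('c \<Rightarrow> real) \<Rightarrow> nat \<Rightarrow> (nat \<Rightarrow> 'l) \<Rightarrow> real" where
  "S_star \<X> U \<phi> r x = inv_sum U \<phi> x (k_star \<X> U \<phi> r x)"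

end

theory Submission imports Defs begin

text \<open>
  When the monitoring sets are disjoint, both objectives see a strategy only through the
  probabilities \<open>p\<^sub>x\<close> with which each location receives a sensor. A component in \<open>U x\<close> is
  monitored exactly when \<open>x\<close> holds a sensor, so the worst component of \<open>U x\<close> is one with the
  minimal security level \<open>a\<^sub>x = phi_bar U \<phi> x\<close>, and it contributes \<open>a\<^sub>x + (1 - a\<^sub>x) p\<^sub>x\<close>. Locations
  outside the node basis have \<open>p\<^sub>x = 0\<close>, which turns their contribution into the minimal \<open>\<phi> u\<close>
  appearing in the second objective. Hence \<open>obj_M\<close> and \<open>obj_M_bar\<close> coincide on strategies
  (\<open>obj_M_eq_INF_locations\<close>, \<open>obj_M_bar_eq_INF_locations\<close>), and so do their optimal values and
  optimal solutions.

  What remains is to maximize \<open>min\<^sub>x (a\<^sub>x + (1 - a\<^sub>x) p\<^sub>x)\<close>. Since at most \<open>r\<close> sensors are placed, linearity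
  of expectation gives the budget \<open>\<Sum>\<^sub>x p\<^sub>x \<le> r\<close>, and this is a water-filling problem. To bring every
  location of a set \<open>I\<close> to level \<open>L\<close> costs \<open>\<Sum>\<^sub>x (1 - (1 - L) / (1 - a\<^sub>x))\<close> over \<open>x \<in> I\<close>, so no strategy exceeds the
  level \<open>1 - (|I| - r) / \<Sum>\<^sub>x 1 / (1 - a\<^sub>x)\<close> on all of \<open>I\<close> (\<open>budget_bound\<close>). Take for \<open>I\<close> the first
  \<open>k\<^sup>*\<close> locations. The maximality of \<open>k\<^sup>*\<close> says that all later locations have
  \<open>a\<^sub>x\<close> above the resulting level already (\<open>threshold_index\<close>), so the prescribed probabilities attain the
  bound everywhere.

  For an optimum to exist, the prescribed probabilities must come from a strategy. This
  is the integrality of the polytope \<open>{p \<in> [0,1]\<^sup>n. \<Sum>\<^sub>x p\<^sub>x \<le> r}\<close>: its points are convex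
  combinations of indicator vectors of sets with at most \<open>r\<close> elements
  (\<open>exists_strategy_with_inclusion_probs\<close>).
\<close>

section \<open>Disjoint monitoring sets reduce both objectives to sensor probabilities\<close>

abbreviation inclusion_prob :: "'l set pmf \<Rightarrow> 'l \<Rightarrow> real" where
  "inclusion_prob \<sigma> x \<equiv> measure_pmf.prob \<sigma> {X. x \<in> X}"

text \<open>
  The expected detection probability of a least secure component of \<open>U x\<close> when the monitoring
  sets are disjoint; as a function of \<open>x\<close> it is the common form of both objectives.
\<close>
definition detection_value :: "('l \<Rightarrow> 'c set) \<Rightarrow> ('c \<Rightarrow> real) \<Rightarrow> 'l set pmf \<Rightarrow> 'l \<Rightarrow> real" where
  "detection_value U \<phi> \<sigma> x = phi_bar U \<phi> x + (1 - phi_bar U \<phi> x) * inclusion_prob \<sigma> x"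

lemma expectation_if_one:
  "measure_pmf.expectation \<sigma> (\<lambda>X. if P X then 1 else c)
     = c + (1 - c) * measure_pmf.prob \<sigma> {X. P X}" for c :: real
proof -
  have "(\<lambda>X. if P X then 1 else c) = (\<lambda>X. c + (1 - c) * indicator {X. P X} X)"
    by (auto simp: fun_eq_iff)
  then have "measure_pmf.expectation \<sigma> (\<lambda>X. if P X then 1 else c)
      = measure_pmf.expectation \<sigma> (\<lambda>X. c + (1 - c) * indicator {X. P X} X)"
    by simp
  also have "\<dots> = c + (1 - c) * measure_pmf.prob \<sigma> {X. P X}"
    by (subst Bochner_Integration.integral_add) (auto simp: less_top[symmetric])
  finally show ?thesis .
qed

lemma inclusion_prob_eq_0:
  assumes "x \<notin> node_basis \<sigma>"
  shows "inclusion_prob \<sigma> x = 0"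
  using assms by (auto simp: measure_pmf_zero_iff node_basis_def)

lemma phi_bar_props:
  assumes "finite (U x)" "U x \<noteq> {}"
  shows phi_bar_le: "\<And>u. u \<in> U x \<Longrightarrow> phi_bar U \<phi> x \<le> \<phi> u"
    and phi_bar_attained: "\<exists>u\<in>U x. phi_bar U \<phi> x = \<phi> u"
proof -
  have "Min (\<phi> ` U x) \<in> \<phi> ` U x"
    using assms by (intro Min_in) auto
  then show "\<exists>u\<in>U x. phi_bar U \<phi> x = \<phi> u"
    by (auto simp: phi_bar_def)
qed (use assms in \<open>auto simp: phi_bar_def\<close>)

lemma monitored_iff_of_disjoint:
  assumes "disjoint_family_on U \<X>" "X \<subseteq> \<X>" "x \<in> \<X>" "u \<in> U x"
  shows "u \<in> monitored U X \<longleftrightarrow> x \<in> X"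
  using assms by (fastforce simp: monitored_def disjoint_family_on_def)

lemma strategies_subset:
  assumes "\<sigma> \<in> strategies \<X> r" "X \<in> set_pmf \<sigma>"
  shows "X \<subseteq> \<X>" "card X \<le> r"
  using assms by (auto simp: strategies_def sensor_placements_def)

lemma expectation_detect_of_disjoint:
  assumes "disjoint_family_on U \<X>" "\<sigma> \<in> strategies \<X> r" "x \<in> \<X>" "u \<in> U x"
  shows "measure_pmf.expectation \<sigma> (\<lambda>X. detect U \<phi> X u) = \<phi> u + (1 - \<phi> u) * inclusion_prob \<sigma> x"
proof -
  have "measure_pmf.prob \<sigma> {X. u \<in> monitored U X} = inclusion_prob \<sigma> x"
    using monitored_iff_of_disjoint[OF assms(1) strategies_subset(1)[OF assms(2)] assms(3,4)]
    by (intro measure_prob_cong_0) (auto simp: set_pmf_iff)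
  then show ?thesis
    unfolding detect_def expectation_if_one by simp
qed

text \<open>
  The value \<open>c + (1 - c) p\<close> is increasing in \<open>c\<close> as long as \<open>p \<le> 1\<close>, so among the components of
  \<open>U x\<close>, which all share the monitoring probability \<open>p\<close>, the minimum sits at the smallest
  security level.
\<close>
lemma obj_M_eq_INF_locations:
  assumes "finite \<U>" "\<And>x. x \<in> \<X> \<Longrightarrow> U x \<noteq> {} \<and> U x \<subseteq> \<U>" "monitored U \<X> = \<U>"
    and "disjoint_family_on U \<X>" "\<sigma> \<in> strategies \<X> r"
  shows "obj_M \<U> U \<phi> \<sigma> = (INF x\<in>\<X>. ereal (detection_value U \<phi> \<sigma> x))"
  unfolding obj_M_def
proof (rule INF_eq)
  fix u assume "u \<in> \<U>"
  then obtain x where x: "x \<in> \<X>" "u \<in> U x"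
    using assms(3) by (auto simp: monitored_def)
  have "phi_bar U \<phi> x \<le> \<phi> u"
    using x assms(1,2) by (intro phi_bar_le) (auto intro: finite_subset)
  then have "0 \<le> (\<phi> u - phi_bar U \<phi> x) * (1 - inclusion_prob \<sigma> x)"
    by simp
  then show "\<exists>x\<in>\<X>. ereal (detection_value U \<phi> \<sigma> x)
      \<le> ereal (measure_pmf.expectation \<sigma> (\<lambda>X. detect U \<phi> X u))"
    using x by (intro bexI[of _ x])
      (auto simp: expectation_detect_of_disjoint[OF assms(4,5) x] detection_value_def
        algebra_simps)
next
  fix x assume x: "x \<in> \<X>"
  then obtain u where u: "u \<in> U x" "phi_bar U \<phi> x = \<phi> u"
    using phi_bar_attained[of U x \<phi>] assms(1,2) by (meson finite_subset)
  show "\<exists>u\<in>\<U>. ereal (measure_pmf.expectation \<sigma> (\<lambda>X. detect U \<phi> X u))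
      \<le> ereal (detection_value U \<phi> \<sigma> x)"
    using u x assms(2) expectation_detect_of_disjoint[OF assms(4,5) x u(1), of \<phi>]
    by (intro bexI[of _ u]) (auto simp: detection_value_def)
qed

text \<open>
  A location that never receives a sensor has detection value \<open>phi_bar U \<phi> x\<close>, the minimum of \<open>\<phi>\<close>
  over \<open>U x\<close>; by disjointness the components unmonitored by the node basis are exactly those of
  such locations. The two parts of the objective therefore combine to one infimum over all of
  \<open>\<X>\<close>.
\<close>
lemma obj_M_bar_eq_INF_locations:
  assumes "finite \<U>" "\<And>x. x \<in> \<X> \<Longrightarrow> U x \<noteq> {} \<and> U x \<subseteq> \<U>" "monitored U \<X> = \<U>"
    and "disjoint_family_on U \<X>" "\<sigma> \<in> strategies \<X> r"
  shows "obj_M_bar \<U> U \<phi> \<sigma> = (INF x\<in>\<X>. ereal (detection_value U \<phi> \<sigma> x))"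
proof -
  let ?B = "node_basis \<sigma>" and ?v = "\<lambda>x. ereal (detection_value U \<phi> \<sigma> x)"
  have B: "?B \<subseteq> \<X>"
    using strategies_subset[OF assms(5)] by (auto simp: node_basis_def)
  have in_basis: "ereal (measure_pmf.expectation \<sigma> (\<lambda>X. detect_bar U \<phi> X x)) = ?v x" for x
    by (simp add: detect_bar_def expectation_if_one detection_value_def)
  have "(INF u\<in>\<U> - monitored U ?B. ereal (\<phi> u)) = (INF x\<in>\<X> - ?B. ?v x)"
  proof (rule INF_eq)
    fix u assume u: "u \<in> \<U> - monitored U ?B"
    then obtain x where x: "x \<in> \<X>" "u \<in> U x"
      using assms(3) by (auto simp: monitored_def)
    have "x \<in> \<X> - ?B" "phi_bar U \<phi> x \<le> \<phi> u"
      using u x assms(1,2) by (auto simp: monitored_def intro!: phi_bar_le intro: finite_subset)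
    then show "\<exists>x\<in>\<X> - ?B. ?v x \<le> ereal (\<phi> u)"
      using inclusion_prob_eq_0[of x \<sigma>] by (intro bexI[of _ x]) (auto simp: detection_value_def)
  next
    fix x assume x: "x \<in> \<X> - ?B"
    then obtain u where u: "u \<in> U x" "phi_bar U \<phi> x = \<phi> u"
      using phi_bar_attained[of U x \<phi>] assms(1,2) by (meson DiffD1 finite_subset)
    have "u \<in> \<U> - monitored U ?B"
      using u x assms(2) monitored_iff_of_disjoint[OF assms(4) B, of x u] by auto
    then show "\<exists>u\<in>\<U> - monitored U ?B. ereal (\<phi> u) \<le> ?v x"
      using u x inclusion_prob_eq_0[of x \<sigma>] by (auto simp: detection_value_def)
  qed
  then have "obj_M_bar \<U> U \<phi> \<sigma> = min (INF x\<in>?B. ?v x) (INF x\<in>\<X> - ?B. ?v x)"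
    by (simp add: obj_M_bar_def in_basis)
  also have "\<dots> = (INF x\<in>?B \<union> (\<X> - ?B). ?v x)"
    by (simp only: INF_union inf_min)
  also have "?B \<union> (\<X> - ?B) = \<X>"
    using B by auto
  finally show ?thesis .
qed

section \<open>Water-filling under the sensor budget\<close>

text \<open>
  The sum is the expectation of \<open>card (I \<inter> X)\<close>, and \<open>X\<close> never has more than \<open>r\<close> elements.
\<close>
lemma sum_inclusion_prob_le:
  assumes "finite \<X>" "\<sigma> \<in> strategies \<X> r" "I \<subseteq> \<X>"
  shows "(\<Sum>x\<in>I. inclusion_prob \<sigma> x) \<le> real r"
proof -
  have I: "finite I"
    using assms(1,3) finite_subset by blast
  have card_bound: "real (card (I \<inter> X)) \<le> real r" if "X \<in> set_pmf \<sigma>" for X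
  proof -
    have "card (I \<inter> X) \<le> card X"
      using strategies_subset(1)[OF assms(2) that] assms(1)
      by (intro card_mono) (auto intro: finite_subset)
    then show ?thesis
      using strategies_subset(2)[OF assms(2) that] by simp
  qed
  have "(\<Sum>x\<in>I. inclusion_prob \<sigma> x) = measure_pmf.expectation \<sigma> (\<lambda>X. \<Sum>x\<in>I. indicator {X. x \<in> X} X)"
    by (subst Bochner_Integration.integral_sum) (auto simp: less_top[symmetric])
  also have "(\<lambda>X. \<Sum>x\<in>I. indicator {X. x \<in> X} X) = (\<lambda>X. real (card (I \<inter> X)))"
    using I by (auto simp: fun_eq_iff indicator_def sum.If_cases Int_def)
  also have "measure_pmf.expectation \<sigma> (\<lambda>X. real (card (I \<inter> X))) \<le> real r"
  proof (rule measure_pmf.integral_le_const)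
    show "integrable (measure_pmf \<sigma>) (\<lambda>X. real (card (I \<inter> X)))"
      using I by (intro measure_pmf.integrable_const_bound[where B = "real (card I)"])
        (auto intro!: card_mono)
  qed (use card_bound in \<open>auto simp: AE_measure_pmf_iff\<close>)
  finally show ?thesis .
qed

text \<open>
  If every \<open>i\<close> exceeded the level \<open>1 - D\<close>, where \<open>D\<close> is the quotient in the statement, then
  \<open>1 - p i < D / (1 - a i)\<close>. Summation over \<open>I\<close> would give \<open>card I - sum p I < card I - R\<close>,
  against the budget.
\<close>
lemma budget_bound:
  fixes a p :: "'i \<Rightarrow> real"
  assumes "finite I" "I \<noteq> {}" "\<And>i. i \<in> I \<Longrightarrow> a i < 1" "sum p I \<le> R"
  shows "\<exists>i\<in>I. a i + (1 - a i) * p i \<le> 1 - (real (card I) - R) / (\<Sum>i\<in>I. inverse (1 - a i))"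
proof (rule ccontr)
  define S where "S = (\<Sum>i\<in>I. inverse (1 - a i))"
  define D where "D = (real (card I) - R) / S"
  assume "\<not> ?thesis"
  then have high: "1 - D < a i + (1 - a i) * p i" if "i \<in> I" for i
    using that by (auto simp: D_def S_def not_le)
  have S: "S > 0"
    unfolding S_def using assms by (intro sum_pos) auto
  have "(\<Sum>i\<in>I. 1 - p i) < (\<Sum>i\<in>I. D * inverse (1 - a i))"
  proof (rule sum_strict_mono)
    fix i assume i: "i \<in> I"
    have "(1 - p i) * (1 - a i) < D"
      using high[OF i] by (simp add: algebra_simps)
    then show "1 - p i < D * inverse (1 - a i)"
      using assms(3)[OF i] by (simp add: field_simps)
  qed (use assms in auto)
  also have "\<dots> = D * S"
    by (simp add: S_def sum_distrib_left)
  also have "\<dots> = real (card I) - R"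
    using S by (simp add: D_def)
  finally show False
    using assms(4) by (simp add: sum_subtractf)
qed

text \<open>
  The level \<open>L = 1 - (k - r) / S k\<close> separates the first \<open>k\<close> entries from the rest. On the first
  \<open>k\<close> entries, \<open>a i \<le> a k \<le> L\<close> by monotonicity and the choice of \<open>k\<close>. Conversely
  \<open>Suc k\<close> violates the defining inequality, and multiplying that violation by
  \<open>S (Suc k) = S k + 1 / (1 - a (Suc k))\<close> cancels the contribution of the new entry on both sides,
  which leaves \<open>(1 - a (Suc k)) * S k < k - r\<close>, that is, \<open>a (Suc k) > L\<close>.
\<close>
lemma threshold_index:
  fixes a :: "nat \<Rightarrow> real"
  assumes mono: "mono_on {1..n} a" and less_1: "\<forall>i\<in>{1..n}. a i < 1"
    and r: "0 < r" "r \<le> n"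
  defines "S \<equiv> \<lambda>k. \<Sum>l=1..k. inverse (1 - a l)"
  defines "k \<equiv> Max {k \<in> {1..n}. a k \<le> 1 - (real k - real r) / S k}"
  shows "k \<in> {r..n}" "S k > 0"
    and "\<And>i. i \<in> {1..k} \<Longrightarrow> a i \<le> 1 - (real k - real r) / S k"
    and "\<And>i. i \<in> {k<..n} \<Longrightarrow> 1 - (real k - real r) / S k \<le> a i"
proof -
  define K where "K = {k \<in> {1..n}. a k \<le> 1 - (real k - real r) / S k}"
  have S_pos: "S j > 0" if "j \<in> {1..n}" for j
    unfolding S_def using that less_1 by (intro sum_pos) auto
  have finK: "finite K"
    by (simp add: K_def)
  \<comment> \<open>At \<open>r\<close> the subtracted quotient vanishes, so \<open>r\<close> itself is a candidate and \<open>k\<close> is at least \<open>r\<close>.\<close>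
  have rK: "r \<in> K"
    using r by (auto simp: K_def intro!: less_imp_le[OF bspec[OF less_1]])
  have k: "k = Max K"
    by (simp add: k_def K_def)
  then have kK: "k \<in> K" and rk: "r \<le> k"
    using Max_in[OF finK] Max_ge[OF finK rK] rK by auto
  then have kn: "k \<in> {1..n}" and level: "a k \<le> 1 - (real k - real r) / S k"
    by (auto simp: K_def)
  show "k \<in> {r..n}" "S k > 0"
    using kn rk S_pos by auto
  show "a i \<le> 1 - (real k - real r) / S k" if "i \<in> {1..k}" for i
    using mono_onD[OF mono, of i k] that kn level by auto
  show "1 - (real k - real r) / S k \<le> a i" if i: "i \<in> {k<..n}" for i
  proof -
    have Suc_k: "Suc k \<in> {1..n}" "Suc k \<notin> K"
      using i Max_ge[OF finK, of "Suc k"] by (auto simp: k)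
    then have "1 - (real (Suc k) - real r) / S (Suc k) < a (Suc k)"
      by (simp add: K_def)
    then have "(1 - a (Suc k)) * S (Suc k) < real (Suc k) - real r"
      using S_pos[OF Suc_k(1)] by (simp add: field_simps)
    moreover have "S (Suc k) = S k + inverse (1 - a (Suc k))"
      by (simp add: S_def)
    then have "(1 - a (Suc k)) * S (Suc k) = (1 - a (Suc k)) * S k + 1"
      using bspec[OF less_1 Suc_k(1)] by (simp add: distrib_left)
    ultimately have "(1 - a (Suc k)) * S k < real k - real r"
      by simp
    then have "1 - (real k - real r) / S k \<le> a (Suc k)"
      using S_pos[OF kn] by (simp add: field_simps)
    also have "\<dots> \<le> a i"
      using mono_onD[OF mono, of "Suc k" i] i by auto
    finally show ?thesis .
  qed
qed

section \<open>Strategies with prescribed sensor probabilities\<close>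

lemma strategies_mix:
  assumes "\<sigma> \<in> strategies \<X> r" "\<tau> \<in> strategies \<X> r" "0 \<le> t" "t \<le> 1"
  shows "\<exists>\<rho>\<in>strategies \<X> r. \<forall>x. inclusion_prob \<rho> x
    = t * inclusion_prob \<sigma> x + (1 - t) * inclusion_prob \<tau> x"
proof (intro bexI allI)
  let ?\<rho> = "bernoulli_pmf t \<bind> (\<lambda>b. if b then \<sigma> else \<tau>)"
  show "?\<rho> \<in> strategies \<X> r"
    using assms by (auto simp: strategies_def split: if_splits)
  fix x
  have "ennreal (inclusion_prob ?\<rho> x) = emeasure (measure_pmf ?\<rho>) {X. x \<in> X}"
    by (simp only: measure_pmf.emeasure_eq_measure)
  also have "\<dots> = (\<integral>\<^sup>+b. emeasure (measure_pmf (if b then \<sigma> else \<tau>)) {X. x \<in> X} \<partial>bernoulli_pmf t)"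
    by (rule emeasure_bind_pmf)
  also have "\<dots> = ennreal (inclusion_prob \<sigma> x) * ennreal t + ennreal (inclusion_prob \<tau> x) * ennreal (1 - t)"
    using assms(3,4) by (simp add: measure_pmf.emeasure_eq_measure)
  also have "\<dots> = ennreal (t * inclusion_prob \<sigma> x + (1 - t) * inclusion_prob \<tau> x)"
    using assms(3,4) by (simp add: ennreal_mult mult.commute)
  finally show "inclusion_prob ?\<rho> x = t * inclusion_prob \<sigma> x + (1 - t) * inclusion_prob \<tau> x"
    using assms(3,4) by (subst (asm) ennreal_inj) auto
qed

text \<open>
  Induction on the number of locations with a fractional probability. With none, \<open>p\<close> is the
  indicator of a set with at most \<open>r\<close> elements. With two, shifting probability from one to the
  other, in either direction, until one of them becomes 0 or 1 keeps the sum and writes \<open>p\<close> as a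
  convex combination of two vectors with fewer fractional entries. With a single one, integrality of
  \<open>r\<close> leaves room to round it up as well as down. Randomizing between the two strategies
  realizes the convex combination.
\<close>
lemma exists_strategy_with_inclusion_probs:
  assumes "finite \<X>"
  shows "\<lbrakk>\<And>x. x \<in> \<X> \<Longrightarrow> 0 \<le> p x \<and> p x \<le> 1; sum p \<X> \<le> real r\<rbrakk>
    \<Longrightarrow> \<exists>\<sigma>\<in>strategies \<X> r. \<forall>x\<in>\<X>. inclusion_prob \<sigma> x = p x"
proof (induction "card {x \<in> \<X>. p x \<noteq> 0 \<and> p x \<noteq> 1}" arbitrary: p rule: less_induct)
  case less
  define frac where "frac = (\<lambda>q::'a \<Rightarrow> real. {x \<in> \<X>. q x \<noteq> 0 \<and> q x \<noteq> 1})"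
  define ones where "ones = {x \<in> \<X>. p x = 1}"
  have IH: "\<exists>\<sigma>\<in>strategies \<X> r. \<forall>x\<in>\<X>. inclusion_prob \<sigma> x = q x"
    if smaller: "frac q \<subset> frac p"
      and "\<And>x. x \<in> \<X> \<Longrightarrow> 0 \<le> q x \<and> q x \<le> 1" "sum q \<X> \<le> real r" for q
  proof (rule less.hyps)
    show "card {x \<in> \<X>. q x \<noteq> 0 \<and> q x \<noteq> 1} < card {x \<in> \<X>. p x \<noteq> 0 \<and> p x \<noteq> 1}"
      using psubset_card_mono[OF _ smaller] assms by (simp add: frac_def)
  qed (use that in auto)
  have combine: ?case
    if parts: "frac q \<subset> frac p" "\<And>x. x \<in> \<X> \<Longrightarrow> 0 \<le> q x \<and> q x \<le> 1" "sum q \<X> \<le> real r"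
        "frac q' \<subset> frac p" "\<And>x. x \<in> \<X> \<Longrightarrow> 0 \<le> q' x \<and> q' x \<le> 1" "sum q' \<X> \<le> real r"
      and t: "0 \<le> t" "t \<le> 1" "\<And>x. x \<in> \<X> \<Longrightarrow> p x = t * q x + (1 - t) * q' x" for q q' t
  proof -
    obtain \<sigma> \<tau> where
      \<sigma>: "\<sigma> \<in> strategies \<X> r" "\<forall>x\<in>\<X>. inclusion_prob \<sigma> x = q x" and
      \<tau>: "\<tau> \<in> strategies \<X> r" "\<forall>x\<in>\<X>. inclusion_prob \<tau> x = q' x"
      using IH[of q] IH[of q'] parts by blast
    show ?thesis
      using strategies_mix[OF \<sigma>(1) \<tau>(1) t(1,2)] \<sigma>(2) \<tau>(2) t(3) by (auto intro!: bexI)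
  qed
  consider "frac p = {}" | x where "frac p = {x}" | x y where "x \<in> frac p" "y \<in> frac p" "x \<noteq> y"
    by blast
  then show ?case
  proof cases
    case 1
    have "sum p \<X> = (\<Sum>x\<in>\<X>. if x \<in> ones then 1 else 0)"
      using 1 by (intro sum.cong) (auto simp: ones_def frac_def)
    also have "\<dots> = real (card ones)"
      using assms by (simp add: sum.If_cases ones_def Int_def conj_commute)
    finally have "return_pmf ones \<in> strategies \<X> r"
      using less.prems(2) by (auto simp: strategies_def sensor_placements_def ones_def)
    moreover have "inclusion_prob (return_pmf ones) x = p x" if "x \<in> \<X>" for x
      using 1 that by (auto simp: ones_def frac_def indicator_def)
    ultimately show ?thesis
      by blast
  next
    case (2 x)
    then have x: "x \<in> \<X>" "0 < p x" "p x < 1"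
      using less.prems(1)[of x] by (auto simp: frac_def order.strict_iff_order)
    have "sum p (\<X> - {x}) = (\<Sum>z\<in>\<X> - {x}. if z \<in> ones then 1 else 0)"
      using 2 by (intro sum.cong) (auto simp: ones_def frac_def)
    also have "\<dots> = real (card ones)"
      using assms x by (auto simp: sum.If_cases ones_def intro!: arg_cong[where f = card])
    finally have rest: "sum p (\<X> - {x}) = real (card ones)" .
    have sum_upd: "sum (p(x := c)) \<X> = c + real (card ones)" for c
      using assms x rest by (simp add: sum.remove[of _ x])
    have "real (card ones) < real r"
      using less.prems(2) sum_upd[of "p x"] x by simp
    then have room: "1 + real (card ones) \<le> real r"
      by simp
    show ?thesis
      by (rule combine[of "p(x := 1)" "p(x := 0)" "p x"])
        (use 2 x less.prems(1) room sum_upd in \<open>auto simp: frac_def\<close>)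
  next
    case (3 x y)
    then have x: "x \<in> \<X>" "0 < p x" "p x < 1" and y: "y \<in> \<X>" "0 < p y" "p y < 1"
      using less.prems(1)[of x] less.prems(1)[of y] by (auto simp: frac_def order.strict_iff_order)
    \<comment> \<open>The largest shifts from \<open>y\<close> to \<open>x\<close> and from \<open>x\<close> to \<open>y\<close> that stay within \<open>[0, 1]\<close>.\<close>
    define d where "d = min (1 - p x) (p y)"
    define e where "e = min (p x) (1 - p y)"
    define q where "q = (\<lambda>c. p(x := p x + c, y := p y - c))"
    have de: "d > 0" "e > 0"
      using x y by (auto simp: d_def e_def)
    have sum_q: "sum (q c) \<X> = sum p \<X>" for c
    proof -
      have "sum (q c) \<X> = (\<Sum>z\<in>\<X>. p z + (if z = x then c else 0) - (if z = y then c else 0))"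
        using \<open>x \<noteq> y\<close> by (intro sum.cong) (auto simp: q_def)
      then show ?thesis
        using assms x y by (simp add: sum.distrib sum_subtractf)
    qed
    have frac_q: "frac (q c) \<subset> frac p" if "q c x \<in> {0, 1} \<or> q c y \<in> {0, 1}" for c
      using that 3 by (auto simp: frac_def q_def split: if_splits)
    \<comment> \<open>The weights are inversely proportional to the shifts, so that the shifts cancel on average.\<close>
    have convex: "p z = e / (d + e) * q d z + (1 - e / (d + e)) * q (- e) z" for z
    proof -
      have "e * q d z + d * q (- e) z = (d + e) * p z"
        using \<open>x \<noteq> y\<close> by (auto simp: q_def algebra_simps)
      then have "p z = (e * q d z + d * q (- e) z) / (d + e)"
        using de by simp
      moreover have "1 - e / (d + e) = d / (d + e)"
        using de by (simp add: field_simps)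
      ultimately show ?thesis
        by (simp add: add_divide_distrib)
    qed
    show ?thesis
    proof (rule combine[of "q d" "q (- e)" "e / (d + e)"])
      show "frac (q d) \<subset> frac p" "frac (q (- e)) \<subset> frac p"
        using \<open>x \<noteq> y\<close> by (intro frac_q; auto simp: q_def d_def e_def min_def)+
      show "0 \<le> q d z \<and> q d z \<le> 1" if "z \<in> \<X>" for z
        using less.prems(1)[OF that] x y by (auto simp: q_def d_def)
      show "0 \<le> q (- e) z \<and> q (- e) z \<le> 1" if "z \<in> \<X>" for z
        using less.prems(1)[OF that] x y by (auto simp: q_def e_def)
    qed (use de less.prems(2) convex sum_q in auto)
  qed
qed

section \<open>Optimality\<close>

lemma exists_sorted_enumeration:
  assumes "finite \<X>"
  shows "\<exists>x. sorted_enumeration \<X> U \<phi> x"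
proof -
  obtain ys where ys: "set ys = \<X>" "distinct ys"
    using finite_distinct_list[OF assms] by blast
  define xs where "xs = sort_key (phi_bar U \<phi>) ys"
  have xs: "set xs = \<X>" "distinct xs" "length xs = card \<X>" "sorted (map (phi_bar U \<phi>) xs)"
    using ys distinct_card[OF ys(2)] by (simp_all add: xs_def)
  have "bij_betw (\<lambda>i. i - 1) {1..card \<X>} {..<card \<X>}"
    by (rule bij_betw_byWitness[of _ Suc]) auto
  then have "bij_betw ((!) xs \<circ> (\<lambda>i. i - 1)) {1..card \<X>} \<X>"
    using xs by (intro bij_betw_trans[OF _ bij_betw_nth[OF xs(2)]]) auto
  moreover have "mono_on {1..card \<X>} (\<lambda>i. phi_bar U \<phi> (xs ! (i - 1)))"
    using sorted_nth_mono[OF xs(4)] xs(3) by (auto intro!: mono_onI)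
  ultimately have "sorted_enumeration \<X> U \<phi> (\<lambda>i. xs ! (i - 1))"
    by (simp add: sorted_enumeration_def comp_def)
  then show ?thesis
    by blast
qed

theorem proposition3:
  fixes \<U> :: "'c set" and \<X> :: "'l set" and U :: "'l \<Rightarrow> 'c set"
    and \<phi> :: "'c \<Rightarrow> real" and r :: nat
  assumes "finite \<U>" and "finite \<X>"
    and "\<And>u. u \<in> \<U> \<Longrightarrow> 0 \<le> \<phi> u \<and> \<phi> u < 1"
    and "\<And>x. x \<in> \<X> \<Longrightarrow> U x \<noteq> {} \<and> U x \<subseteq> \<U>"
    and "monitored U \<X> = \<U>"
    and "0 < r" and "r < min_cover_size \<U> \<X> U"
    and "disjoint_family_on U \<X>"
  shows "(\<exists>\<sigma>. optimal_M \<U> \<X> U \<phi> r \<sigma>) \<and> (\<exists>\<sigma>. optimal_M_bar \<U> \<X> U \<phi> r \<sigma>)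
    \<and> z_M_bar \<U> \<X> U \<phi> r = z_M \<U> \<X> U \<phi> r
    \<and> (\<forall>x \<sigma>. sorted_enumeration \<X> U \<phi> x \<longrightarrow> \<sigma> \<in> strategies \<X> r \<longrightarrow>
         (\<forall>y\<in>\<X>. measure_pmf.prob \<sigma> {X. y \<in> X} =
            (if y \<in> x ` {1..k_star \<X> U \<phi> r x}
             then 1 - (real (k_star \<X> U \<phi> r x) - real r)
                        / ((1 - phi_bar U \<phi> y) * S_star \<X> U \<phi> r x)
             else 0)) \<longrightarrow>
         optimal_M \<U> \<X> U \<phi> r \<sigma>)"
proof -
  let ?a = "phi_bar U \<phi>"
  let ?k = "k_star \<X> U \<phi> r" and ?S = "S_star \<X> U \<phi> r"
  let ?p = "\<lambda>x y. if y \<in> x ` {1..?k x} then 1 - (real (?k x) - real r) / ((1 - ?a y) * ?S x) else 0"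
  let ?level = "\<lambda>x. 1 - (real (?k x) - real r) / ?S x"
  have obj_M: "obj_M \<U> U \<phi> \<sigma> = (INF x\<in>\<X>. ereal (detection_value U \<phi> \<sigma> x))"
    and obj_M_bar: "obj_M_bar \<U> U \<phi> \<sigma> = (INF x\<in>\<X>. ereal (detection_value U \<phi> \<sigma> x))"
    if "\<sigma> \<in> strategies \<X> r" for \<sigma>
    using obj_M_eq_INF_locations[OF assms(1,4,5,8) that]
      obj_M_bar_eq_INF_locations[OF assms(1,4,5,8) that] by simp_all
  have same_obj: "obj_M_bar \<U> U \<phi> \<sigma> = obj_M \<U> U \<phi> \<sigma>" if "\<sigma> \<in> strategies \<X> r" for \<sigma>
    using obj_M[OF that] obj_M_bar[OF that] by simp
  have a_less_1: "?a y < 1" if "y \<in> \<X>" for y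
    using phi_bar_attained[of U y \<phi>] assms(1,3) assms(4)[OF that]
    by (metis finite_subset subsetD)
  have r_le: "r \<le> card \<X>"
  proof -
    have "min_cover_size \<U> \<X> U \<le> card \<X>"
      unfolding min_cover_size_def
    proof (rule Min_le)
      have "{C. set_cover \<U> \<X> U C} \<subseteq> Pow \<X>"
        by (auto simp: set_cover_def)
      then show "finite (card ` {C. set_cover \<U> \<X> U C})"
        using assms(2) by (meson finite_Pow_iff finite_imageI finite_subset)
    qed (use assms(5) in \<open>auto simp: set_cover_def\<close>)
    then show ?thesis
      using assms(7) by simp
  qed
  have enum: "inj_on x {1..?k x}" "x ` {1..?k x} \<subseteq> \<X>" "?k x \<in> {r..card \<X>}" "?S x > 0"
    "?S x = (\<Sum>y\<in>x ` {1..?k x}. inverse (1 - ?a y))"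
    "\<And>y. y \<in> x ` {1..?k x} \<Longrightarrow> ?a y \<le> ?level x"
    "\<And>y. y \<in> \<X> - x ` {1..?k x} \<Longrightarrow> ?level x \<le> ?a y"
    if x: "sorted_enumeration \<X> U \<phi> x" for x
  proof -
    have bij: "bij_betw x {1..card \<X>} \<X>" and mono: "mono_on {1..card \<X>} (\<lambda>i. ?a (x i))"
      using x by (auto simp: sorted_enumeration_def)
    have less: "\<forall>i\<in>{1..card \<X>}. ?a (x i) < 1"
      using bij a_less_1 by (auto dest: bij_betwE)
    note th = threshold_index[OF mono less assms(6) r_le,
        folded inv_sum_def, folded k_star_def, folded S_star_def]
    show k: "?k x \<in> {r..card \<X>}" and "?S x > 0"
      using th by auto
    show inj: "inj_on x {1..?k x}"
      using bij k by (auto simp: bij_betw_def intro: inj_on_subset)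
    show "x ` {1..?k x} \<subseteq> \<X>"
      using bij k by (auto dest: bij_betwE)
    show "?S x = (\<Sum>y\<in>x ` {1..?k x}. inverse (1 - ?a y))"
      unfolding sum.reindex[OF inj] by (simp add: S_star_def inv_sum_def)
    show "?a y \<le> ?level x" if "y \<in> x ` {1..?k x}" for y
      using that th(3) by auto
    show "?level x \<le> ?a y" if y: "y \<in> \<X> - x ` {1..?k x}" for y
    proof -
      obtain i where "i \<in> {1..card \<X>}" "y = x i"
        using y bij_betw_imp_surj_on[OF bij] by blast
      then show ?thesis
        using th(4)[of i] y by (cases "i \<le> ?k x") auto
    qed
  qed
  \<comment> \<open>No strategy can lift all of the first \<open>k\<^sup>*\<close> locations above the level.\<close>
  have upper: "obj_M \<U> U \<phi> \<tau> \<le> ereal (?level x)"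
    if x: "sorted_enumeration \<X> U \<phi> x" and \<tau>: "\<tau> \<in> strategies \<X> r" for x \<tau>
  proof -
    let ?I = "x ` {1..?k x}"
    have "\<exists>y\<in>?I. ?a y + (1 - ?a y) * inclusion_prob \<tau> y
        \<le> 1 - (real (card ?I) - real r) / (\<Sum>y\<in>?I. inverse (1 - ?a y))"
      using enum(2,3)[OF x] assms(6) a_less_1 sum_inclusion_prob_le[OF assms(2) \<tau> enum(2)[OF x]]
      by (intro budget_bound) auto
    then obtain y where "y \<in> ?I" "detection_value U \<phi> \<tau> y \<le> ?level x"
      using card_image[OF enum(1)[OF x]] enum(5)[OF x] by (auto simp: detection_value_def)
    then show ?thesis
      unfolding obj_M[OF \<tau>] using enum(2)[OF x] by (intro INF_lower2[of y]) auto
  qed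
  \<comment> \<open>The prescribed probability is the solution \<open>p\<close> of \<open>a + (1 - a) p = level\<close> on the first \<open>k\<^sup>*\<close>
    locations; the others are at or above the level without any sensor.\<close>
  have optimal: "optimal_M \<U> \<X> U \<phi> r \<sigma>"
    if x: "sorted_enumeration \<X> U \<phi> x" and \<sigma>: "\<sigma> \<in> strategies \<X> r"
      and p: "\<forall>y\<in>\<X>. inclusion_prob \<sigma> y = ?p x y" for x \<sigma>
  proof -
    have "?level x \<le> detection_value U \<phi> \<sigma> y" if y: "y \<in> \<X>" for y
      using enum(4)[OF x] enum(7)[OF x, of y] a_less_1[OF y] p y
      by (auto simp: detection_value_def divide_simps) (auto simp: algebra_simps)
    then have "ereal (?level x) \<le> obj_M \<U> U \<phi> \<sigma>"
      unfolding obj_M[OF \<sigma>] by (intro INF_greatest) auto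
    then have "obj_M \<U> U \<phi> \<tau> \<le> obj_M \<U> U \<phi> \<sigma>" if "\<tau> \<in> strategies \<X> r" for \<tau>
      using upper[OF x that] order_trans by blast
    then show ?thesis
      using \<sigma> unfolding optimal_M_def is_arg_max_def by (meson leD)
  qed
  have exists: "\<exists>\<sigma>. optimal_M \<U> \<X> U \<phi> r \<sigma>"
  proof -
    obtain x where x: "sorted_enumeration \<X> U \<phi> x"
      using exists_sorted_enumeration[OF assms(2)] by blast
    let ?I = "x ` {1..?k x}" and ?D = "real (?k x) - real r"
    \<comment> \<open>Nonnegativity of the prescribed probabilities is \<open>a \<le> level\<close>; that they are at most 1 is
      \<open>r \<le> k\<^sup>*\<close>.\<close>
    have prob: "0 \<le> ?p x y \<and> ?p x y \<le> 1" if y: "y \<in> \<X>" for y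
    proof (cases "y \<in> ?I")
      case True
      have "?D / ?S x \<le> 1 - ?a y"
        using enum(6)[OF x True] by simp
      then have "?D \<le> (1 - ?a y) * ?S x"
        using enum(4)[OF x] by (simp add: pos_divide_le_eq)
      then have "0 \<le> ?D / ((1 - ?a y) * ?S x)" "?D / ((1 - ?a y) * ?S x) \<le> 1"
        using enum(3,4)[OF x] a_less_1[OF y] by simp_all
      then show ?thesis
        using True by simp
    qed simp
    have "sum (?p x) \<X> = (\<Sum>y\<in>?I. 1 - ?D / ((1 - ?a y) * ?S x))"
      using assms(2) enum(2)[OF x] by (simp add: sum.If_cases Int_absorb1)
    also have "\<dots> = real (card ?I) - ?D / ?S x * (\<Sum>y\<in>?I. inverse (1 - ?a y))"
      by (simp add: sum_subtractf sum_distrib_left divide_inverse mult_ac)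
    also have "\<dots> = real r"
      unfolding enum(5)[OF x, symmetric] using enum(4)[OF x] card_image[OF enum(1)[OF x]] by simp
    finally obtain \<sigma> where "\<sigma> \<in> strategies \<X> r" "\<forall>y\<in>\<X>. inclusion_prob \<sigma> y = ?p x y"
      using exists_strategy_with_inclusion_probs[OF assms(2), of "?p x" r] prob by auto
    then show ?thesis
      using optimal[OF x] by blast
  qed
  have "optimal_M_bar \<U> \<X> U \<phi> r \<sigma> \<longleftrightarrow> optimal_M \<U> \<X> U \<phi> r \<sigma>" for \<sigma>
    using same_obj by (auto simp: optimal_M_def optimal_M_bar_def is_arg_max_def)
  moreover have "z_M_bar \<U> \<X> U \<phi> r = z_M \<U> \<X> U \<phi> r"
    unfolding z_M_def z_M_bar_def using same_obj by (intro SUP_cong) auto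
  ultimately show ?thesis
    using exists optimal by blast
qed

end
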